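(* Let $n$ be a positive integer and $\sigma=(r_1,\dots,r_k)$ a composition of $n$, with partial sums $s_i=r_1+\cdots+r_i$ for $i\in[k]$. Let $h_i(\sigma)$ be the number of points $(a_1,\dots,a_n)\in\mathbb{N}^n$ with $a_1+\cdots+a_{s_i}\le s_i$ for all $i\in[k]$ which have exactly $i$ nonzero coordinates, and let $h(\sigma,t)=\sum_{i=0}^n h_i(\sigma)t^i$. Then $h(\sigma,t)$ is $\gamma$-positive, i.e. there exist nonnegative integers $\gamma_i(\sigma)$, $0\le i\le\lfloor n/2\rfloor$, such that \[ h(\sigma,t)=\sum_{i=0}^{\lfloor n/2\rfloor}\gamma_i(\sigma)\,t^i(1+t)^{n-2i}. \] In particular, the vector $(h_0(\sigma),\dots,h_n(\sigma))$ is palindromic ($h_i(\sigma)=h_{n-i}(\sigma)$ for all $i$) and unimodal ($h_0(\sigma)\le h_1(\sigma)\le\cdots\le h_{\lfloor n/2\rfloor}(\sigma)$).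
   Context: $\mathbb{N}=\{0,1,2,\dots\}$, $[n]=\{1,\dots,n\}$. A composition of $n$ is a sequence of positive integers summing to $n$. The composition polytope $Q_\sigma\subset\mathbb{R}^n$ is defined by $x_j\ge0$ for $j\in[n]$ and $x_1+\cdots+x_{s_i}\le s_i$ for $i\in[k]$; $h_i(\sigma)$ counts its lattice points with exactly $i$ nonzero coordinates. *)

theory Defs
  imports "HOL-Library.FuncSet" "HOL-Computational_Algebra.Polynomial"
begin

definition is_composition :: "nat \<Rightarrow> nat list \<Rightarrow> bool" where
  "is_composition n \<sigma> \<longleftrightarrow> (\<forall>r\<in>set \<sigma>. 0 < r) \<and> sum_list \<sigma> = n"

definition partial_sum :: "nat list \<Rightarrow> nat \<Rightarrow> nat" where
  "partial_sum \<sigma> i = sum_list (take i \<sigma>)"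

text \<open>Points of \<open>\<nat>\<^sup>n\<close>, \<open>n = sum_list \<sigma>\<close>, are extensional functions on \<open>{1..n}\<close>
  (equal to \<open>undefined\<close> outside), so that each tuple is counted once.\<close>

definition lattice_points :: "nat list \<Rightarrow> (nat \<Rightarrow> nat) set" where
  "lattice_points \<sigma> =
     {a \<in> {1..sum_list \<sigma>} \<rightarrow>\<^sub>E (UNIV :: nat set).
        \<forall>i\<in>{1..length \<sigma>}. (\<Sum>j=1..partial_sum \<sigma> i. a j) \<le> partial_sum \<sigma> i}"

definition h :: "nat list \<Rightarrow> nat \<Rightarrow> nat" where
  "h \<sigma> i = card {a \<in> lattice_points \<sigma>. card {j \<in> {1..sum_list \<sigma>}. a j \<noteq> 0} = i}"

definition h_poly :: "nat list \<Rightarrow> int poly" where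
  "h_poly \<sigma> = (\<Sum>i\<le>sum_list \<sigma>. monom (int (h \<sigma> i)) i)"

text \<open>The cardinalities above are those of finite sets.\<close>

lemma finite_lattice_points: "finite (lattice_points \<sigma>)"
proof (cases "\<sigma> = []")
  case True
  then show ?thesis by (simp add: lattice_points_def)
next
  case False
  define n where "n = sum_list \<sigma>"
  have "lattice_points \<sigma> \<subseteq> {1..n} \<rightarrow>\<^sub>E {0..n}"
  proof
    fix a assume a: "a \<in> lattice_points \<sigma>"
    have "length \<sigma> \<in> {1..length \<sigma>}" using False by (cases \<sigma>) auto
    with a have le: "(\<Sum>j=1..n. a j) \<le> n"
      unfolding lattice_points_def partial_sum_def n_def by force
    have "a j \<le> n" if "j \<in> {1..n}" for j
      using member_le_sum[of j "{1..n}" a] that le by simp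
    with a show "a \<in> {1..n} \<rightarrow>\<^sub>E {0..n}"
      unfolding lattice_points_def n_def by (auto simp: PiE_iff)
  qed
  moreover have "finite ({1..n} \<rightarrow>\<^sub>E {0..n})" by (intro finite_PiE) auto
  ultimately show ?thesis by (rule finite_subset)
qed

end

theory Submission
  imports Defs "HOL-Library.Infinite_Set"
begin

text \<open>
  Encode a point \<open>a\<close> by its support \<open>S\<close> and the set \<open>T\<close> of the partial sums
  \<open>a\<^sub>1 + \<dots> + a\<^sub>x\<close> with \<open>x \<in> S\<close>. These are two sets of the same size, and
  \<open>a\<^sub>1 + \<dots> + a\<^sub>s \<le> s\<close> says exactly that \<open>S\<close> has no more elements in \<open>{1..s}\<close> than \<open>T\<close>. This
  condition depends only on \<open>S - T\<close> and \<open>T - S\<close>, while every position outside these two sets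
  independently belongs to both or to neither of \<open>S\<close> and \<open>T\<close>. If \<open>j\<close> is the common size of
  \<open>S - T\<close> and \<open>T - S\<close>, this gives the factor \<open>t\<^sup>j (1 + t)\<^sup>n\<^sup>-\<^sup>2\<^sup>j\<close>, so \<open>\<gamma>\<^sub>j\<close> counts the pairs
  of disjoint \<open>j\<close>-sets with the domination condition.
\<close>

text \<open>In the application \<open>P\<close> is the set of partial sums of the composition; it
  enters through \<open>P \<subseteq> {..n}\<close> and \<open>n \<in> P\<close>.\<close>

definition dominated_pairs :: "nat set \<Rightarrow> nat \<Rightarrow> nat \<Rightarrow> (nat set \<times> nat set) set" where
  "dominated_pairs P n i = {(S, T). S \<subseteq> {1..n} \<and> T \<subseteq> {1..n} \<and> card S = i \<and> card T = i \<and>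
     (\<forall>s\<in>P. card (S \<inter> {1..s}) \<le> card (T \<inter> {1..s}))}"

definition disjoint_dominated_pairs :: "nat set \<Rightarrow> nat \<Rightarrow> nat \<Rightarrow> (nat set \<times> nat set) set" where
  "disjoint_dominated_pairs P n j = {(D, U) \<in> dominated_pairs P n j. D \<inter> U = {}}"

definition bounded_points :: "nat set \<Rightarrow> nat \<Rightarrow> nat \<Rightarrow> (nat \<Rightarrow> nat) set" where
  "bounded_points P n i = {a \<in> {1..n} \<rightarrow>\<^sub>E UNIV.
     (\<forall>s\<in>P. (\<Sum>j=1..s. a j) \<le> s) \<and> card {j \<in> {1..n}. a j \<noteq> 0} = i}"

definition support_and_sums :: "nat \<Rightarrow> (nat \<Rightarrow> nat) \<Rightarrow> nat set \<times> nat set" where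
  "support_and_sums n a =
     (let S = {j \<in> {1..n}. a j \<noteq> 0} in (S, (\<lambda>x. \<Sum>j=1..x. a j) ` S))"

lemma finite_dominated_pairs: "finite (dominated_pairs P n i)"
  by (rule finite_subset[of _ "Pow {1..n} \<times> Pow {1..n}"]) (auto simp: dominated_pairs_def)

section \<open>Prefix sums of a single point\<close>

context
  fixes n :: nat and a :: "nat \<Rightarrow> nat" and A :: "nat \<Rightarrow> nat" and S :: "nat set"
  defines "A \<equiv> \<lambda>x. \<Sum>j=1..x. a j" and "S \<equiv> {j \<in> {1..n}. a j \<noteq> 0}"
begin

lemma prefix_sum_mono: "x \<le> y \<Longrightarrow> A x \<le> A y"
  unfolding A_def by (intro sum_mono2) auto

lemma prefix_sum_less:
  assumes "x < y" "y \<in> S" shows "A x < A y"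
proof -
  obtain z where z: "y = Suc z" using assms by (cases y) auto
  have "A x \<le> A z" using assms z by (intro prefix_sum_mono) auto
  also have "A z < A y" using assms z by (simp add: A_def S_def)
  finally show ?thesis .
qed

lemma inj_on_prefix_sum: "inj_on A S"
  by (rule linorder_inj_onI) (use prefix_sum_less in fastforce)+

text \<open>Prefix sums stay constant off the support, so \<open>A x\<close> is already reached at
  the last support position up to \<open>x\<close>, if there is one.\<close>

lemma prefix_sum_attained:
  assumes "x \<le> n"
  shows "A x = 0 \<and> S \<inter> {1..x} = {} \<or> (\<exists>m \<in> S \<inter> {1..x}. A m = A x)"
  using assms
proof (induction x)
  case 0
  then show ?case by (simp add: A_def)
next
  case (Suc x)
  show ?case
  proof (cases "a (Suc x) = 0")
    case True
    then have "A (Suc x) = A x" "S \<inter> {1..Suc x} = S \<inter> {1..x}"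
      by (auto simp: A_def S_def atLeastAtMostSuc_conv)
    then show ?thesis using Suc by auto
  next
    case False
    then show ?thesis using Suc by (auto simp: S_def)
  qed
qed

lemma prefix_sum_in: "x \<le> n \<Longrightarrow> A x \<in> insert 0 (A ` S)"
  using prefix_sum_attained by (metis IntD1 imageI insertCI)

lemma prefix_sums_below:
  assumes "x \<le> n"
  shows "A ` S \<inter> {..A x} = A ` (S \<inter> {1..x})"
proof -
  have "y \<le> x" if "y \<in> S" "A y \<le> A x" for y
    using that prefix_sum_less[of x y] by (cases "y \<le> x") auto
  moreover have "1 \<le> y" if "y \<in> S" for y using that by (simp add: S_def)
  ultimately show ?thesis using prefix_sum_mono[of _ x] by auto
qed

text \<open>The rank of \<open>A x\<close> among the recorded sums can be read off from the support
  alone. Both the domination criterion and the injectivity of the encoding rest on this.\<close>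

lemma card_prefix_sums_below:
  assumes "x \<le> n"
  shows "card (A ` S \<inter> {..A x}) = card (S \<inter> {1..x})"
  unfolding prefix_sums_below[OF assms]
  by (intro card_image inj_on_subset[OF inj_on_prefix_sum]) auto

text \<open>The left-hand cardinality counts the recorded sums up to \<open>A s\<close>. If
  \<open>A s \<le> s\<close>, all of them lie in \<open>{1..s}\<close>; otherwise \<open>A s\<close>
  is itself a recorded sum beyond \<open>s\<close>, and the count in \<open>{1..s}\<close> is
  strictly smaller.\<close>

lemma prefix_sum_le_iff_dominated:
  assumes "s \<le> n"
  shows "A s \<le> s \<longleftrightarrow> card (S \<inter> {1..s}) \<le> card (A ` S \<inter> {1..s})"
proof -
  have pos: "A ` S \<inter> {1..s} = A ` S \<inter> {..s}"
  proof -
    have "0 < A y" if "y \<in> S" for y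
      using prefix_sum_less[of 0 y] that by (auto simp: S_def)
    then show ?thesis by (auto simp: Suc_le_eq)
  qed
  show ?thesis
  proof
    assume "A s \<le> s"
    then have "A ` S \<inter> {..A s} \<subseteq> A ` S \<inter> {1..s}" unfolding pos by auto
    from card_mono[OF _ this] show "card (S \<inter> {1..s}) \<le> card (A ` S \<inter> {1..s})"
      by (simp add: card_prefix_sums_below[OF assms])
  next
    assume le: "card (S \<inter> {1..s}) \<le> card (A ` S \<inter> {1..s})"
    show "A s \<le> s"
    proof (rule ccontr)
      assume gt: "\<not> A s \<le> s"
      then obtain m where m: "m \<in> S \<inter> {1..s}" "A m = A s"
        using prefix_sum_attained[OF assms] by auto
      then have "A s \<in> A ` S" by (metis IntD1 imageI)
      then have "A ` S \<inter> {1..s} \<subset> A ` S \<inter> {..A s}" using gt unfolding pos by auto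
      from psubset_card_mono[OF _ this] le show False
        by (simp add: card_prefix_sums_below[OF assms])
    qed
  qed
qed

end

section \<open>Bijection between points and dominated pairs\<close>

lemma support_and_sums_in:
  assumes P: "P \<subseteq> {..n}" "n \<in> P" and a: "a \<in> bounded_points P n i"
  shows "support_and_sums n a \<in> dominated_pairs P n i"
proof -
  define A where "A = (\<lambda>x. \<Sum>j=1..x. a j)"
  define S where "S = {j \<in> {1..n}. a j \<noteq> 0}"
  have le: "A s \<le> s" if "s \<in> P" for s
    using a that by (simp add: bounded_points_def A_def)
  have "A x \<in> {1..n}" if "x \<in> S" for x
  proof -
    have "x \<le> n" "0 < x" using that by (auto simp: S_def)
    moreover have "A 0 < A x"
      using prefix_sum_less[of 0 x n a] that \<open>0 < x\<close> unfolding A_def S_def by blast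
    \<comment> \<open>The constraint at \<open>n \<in> P\<close> bounds the total by
      \<open>n\<close>, which keeps all recorded sums inside \<open>{1..n}\<close>.\<close>
    moreover have "A x \<le> A n" using \<open>x \<le> n\<close> unfolding A_def by (rule prefix_sum_mono)
    ultimately show ?thesis using le[OF P(2)] by simp
  qed
  moreover have "card (A ` S) = card S"
    unfolding A_def S_def by (intro card_image inj_on_prefix_sum)
  moreover have "card S = i" using a by (simp add: bounded_points_def S_def)
  moreover have "card (S \<inter> {1..s}) \<le> card (A ` S \<inter> {1..s})" if "s \<in> P" for s
    using prefix_sum_le_iff_dominated[of s n a] le[OF that] P that
    unfolding A_def S_def by blast
  moreover have "S \<subseteq> {1..n}" by (auto simp: S_def)
  ultimately show ?thesis
    unfolding support_and_sums_def Let_def S_def[symmetric] A_def[symmetric]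
    by (auto simp: dominated_pairs_def)
qed

text \<open>Each prefix sum is 0 or a recorded sum, and its rank is fixed by the support; hence all
  prefix sums, and their differences, are determined.\<close>

lemma inj_on_support_and_sums: "inj_on (support_and_sums n) ({1..n} \<rightarrow>\<^sub>E UNIV)"
proof (rule inj_onI)
  fix a b :: "nat \<Rightarrow> nat"
  assume ext: "a \<in> {1..n} \<rightarrow>\<^sub>E UNIV" "b \<in> {1..n} \<rightarrow>\<^sub>E UNIV"
    and eq: "support_and_sums n a = support_and_sums n b"
  define A where "A = (\<lambda>x. \<Sum>j=1..x. a j)"
  define B where "B = (\<lambda>x. \<Sum>j=1..x. b j)"
  define S where "S = {j \<in> {1..n}. a j \<noteq> 0}"
  have S': "S = {j \<in> {1..n}. b j \<noteq> 0}" and T: "A ` S = B ` S"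
    using eq by (auto simp: support_and_sums_def Let_def S_def A_def B_def)
  have fin: "finite S" by (simp add: S_def)
  have eqAB: "A x = B x" if "x \<le> n" for x
  proof -
    have "card (A ` S \<inter> {..A x}) = card (S \<inter> {1..x})"
      unfolding A_def S_def by (rule card_prefix_sums_below[OF that])
    moreover have "card (A ` S \<inter> {..B x}) = card (S \<inter> {1..x})"
      unfolding T unfolding B_def S' by (rule card_prefix_sums_below[OF that])
    ultimately have card_eq: "card (A ` S \<inter> {..A x}) = card (A ` S \<inter> {..B x})" by simp
    have "A x \<in> insert 0 (A ` S)"
      unfolding A_def S_def by (rule prefix_sum_in[OF that])
    moreover have "B x \<in> insert 0 (A ` S)"
      unfolding T unfolding B_def S' by (rule prefix_sum_in[OF that])
    \<comment> \<open>Of two distinct candidates the larger one, \<open>v\<close>, is nonzero, so it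
      is a recorded sum that only the second count includes.\<close>
    moreover have False if "v \<in> A ` S" "u < v"
      "card (A ` S \<inter> {..u}) = card (A ` S \<inter> {..v})" for u v
    proof -
      have "v \<in> A ` S \<inter> {..v}" "v \<notin> A ` S \<inter> {..u}" "A ` S \<inter> {..u} \<subseteq> A ` S \<inter> {..v}"
        using that by simp_all (use that in auto)
      then have "A ` S \<inter> {..u} \<subset> A ` S \<inter> {..v}" by blast
      from psubset_card_mono[OF _ this] show False using that fin by simp
    qed
    ultimately show ?thesis using card_eq by (metis insertE linorder_neqE_nat not_less0)
  qed
  have "a j = b j" if "j \<in> {1..n}" for j
  proof -
    obtain k where k: "j = Suc k" using \<open>j \<in> {1..n}\<close> by (cases j) auto
    then show ?thesis using eqAB[of j] eqAB[of k] that by (simp add: A_def B_def)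
  qed
  then show "a = b" using ext by (intro PiE_ext) auto
qed

text \<open>Surjectivity: the point is built so that its prefix sums climb through the elements of
  \<open>T\<close> in increasing order, one at each position in \<open>S\<close>.\<close>

lemma dominated_pair_from_point:
  assumes P: "P \<subseteq> {..n}" and ST: "(S, T) \<in> dominated_pairs P n i"
  obtains a where "a \<in> bounded_points P n i" "support_and_sums n a = (S, T)"
proof -
  have S: "S \<subseteq> {1..n}" "card S = i" and T: "T \<subseteq> {1..n}" "card T = i"
    and dom: "\<And>s. s \<in> P \<Longrightarrow> card (S \<inter> {1..s}) \<le> card (T \<inter> {1..s})"
    using ST by (auto simp: dominated_pairs_def)
  have fin: "finite S" "finite T" using S T by (auto intro: finite_subset)
  have "0 \<notin> T" using T by auto
  \<comment> \<open>Adding 0 to \<open>T\<close> makes \<open>F 0 = 0\<close> the prefix sum before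
    the first support position.\<close>
  then have cT: "card (insert 0 T) = Suc i" using fin T by simp
  obtain F where bij: "bij_betw F {..<Suc i} (insert 0 T)"
    and mono: "strict_mono_on {..<Suc i} F"
    using ex_bij_betw_strict_mono_card[of "insert 0 T"] fin cT by auto
  have F_less: "F x < F y" if "x < y" "y \<le> i" for x y
    using strict_mono_onD[OF mono] that by auto
  have F0: "F 0 = 0"
  proof -
    have "0 \<in> F ` {..<Suc i}" using bij by (simp add: bij_betw_def)
    then obtain k where "k \<le> i" "F k = 0" by (metis imageE lessThan_iff less_Suc_eq_le)
    then show ?thesis using F_less[of 0 k] by (cases "k = 0") auto
  qed
  define c where "c x = card (S \<inter> {1..x})" for x
  have c_le: "c x \<le> i" for x
    unfolding c_def S(2)[symmetric] by (rule card_mono) (use fin in auto)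
  have c_Suc: "c (Suc x) = (if Suc x \<in> S then Suc (c x) else c x)" for x
    by (simp add: c_def atLeastAtMostSuc_conv)
  \<comment> \<open>The differences telescope to \<open>F (c x)\<close>; the subtraction never
    truncates because \<open>F\<close> and \<open>c\<close> are monotone.\<close>
  define a where "a = (\<lambda>x\<in>{1..n}. F (c x) - F (c (x - 1)))"
  have sums: "(\<Sum>j=1..x. a j) = F (c x)" if "x \<le> n" for x
    using that
  proof (induction x)
    case 0
    then show ?case by (simp add: c_def F0)
  next
    case (Suc x)
    have "F (c x) \<le> F (c (Suc x))"
      using F_less[of "c x" "c (Suc x)"] c_le[of "Suc x"] by (auto simp: c_Suc)
    then show ?case using Suc by (simp add: a_def)
  qed
  have supp: "{j \<in> {1..n}. a j \<noteq> 0} = S"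
  proof -
    have "a j \<noteq> 0 \<longleftrightarrow> j \<in> S" if "j \<in> {1..n}" for j
    proof -
      obtain k where k: "j = Suc k" using \<open>j \<in> {1..n}\<close> by (cases j) auto
      then show ?thesis
        using that F_less[of "c k" "c (Suc k)"] c_le[of "Suc k"] by (auto simp: a_def c_Suc)
    qed
    then show ?thesis using S by auto
  qed
  have "F (c x) \<in> T" if "x \<in> S" for x
  proof -
    have "x \<in> S \<inter> {1..x}" using that S by auto
    then have "0 < c x" using fin unfolding c_def card_gt_0_iff by blast
    then have "F (c x) \<noteq> 0" using F_less[of 0 "c x"] c_le[of x] by simp
    moreover have "F (c x) \<in> insert 0 T"
      using bij c_le[of x] by (auto simp: bij_betw_def less_Suc_eq_le)
    ultimately show ?thesis by simp
  qed
  then have sub: "(\<lambda>x. \<Sum>j=1..x. a j) ` S \<subseteq> T" using sums S by (auto simp: subset_iff)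
  moreover have "card ((\<lambda>x. \<Sum>j=1..x. a j) ` S) = card T"
    using card_image[OF inj_on_prefix_sum[of a n]] S T unfolding supp by simp
  ultimately have im: "(\<lambda>x. \<Sum>j=1..x. a j) ` S = T"
    using fin by (intro card_subset_eq) auto
  have "(\<Sum>j=1..s. a j) \<le> s" if "s \<in> P" for s
    using prefix_sum_le_iff_dominated[of s n a] P dom[OF that] that
    unfolding supp im by auto
  moreover have "a \<in> {1..n} \<rightarrow>\<^sub>E UNIV" by (simp add: a_def)
  ultimately have "a \<in> bounded_points P n i"
    using S(2) unfolding bounded_points_def mem_Collect_eq supp by blast
  moreover have "support_and_sums n a = (S, T)"
    unfolding support_and_sums_def supp Let_def im ..
  ultimately show ?thesis by (rule that)
qed

lemma card_bounded_points:
  assumes "P \<subseteq> {..n}" "n \<in> P"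
  shows "card (bounded_points P n i) = card (dominated_pairs P n i)"
proof (rule bij_betw_same_card)
  show "bij_betw (support_and_sums n) (bounded_points P n i) (dominated_pairs P n i)"
    unfolding bij_betw_def
  proof (intro conjI subset_antisym)
    show "inj_on (support_and_sums n) (bounded_points P n i)"
      by (rule inj_on_subset[OF inj_on_support_and_sums]) (auto simp: bounded_points_def)
    show "support_and_sums n ` bounded_points P n i \<subseteq> dominated_pairs P n i"
      using support_and_sums_in[OF assms] by blast
    show "dominated_pairs P n i \<subseteq> support_and_sums n ` bounded_points P n i"
      using dominated_pair_from_point[OF assms(1)] by (smt (verit) imageI subrelI)
  qed
qed

section \<open>Splitting off the common part of a pair\<close>

lemma card_dominated_pairs:
  "card (dominated_pairs P n i) =
     (\<Sum>j\<le>n div 2. card (disjoint_dominated_pairs P n j) *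
        (if j \<le> i then (n - 2 * j) choose (i - j) else 0))"
proof -
  \<comment> \<open>\<open>B\<close> is the common part, any set of \<open>i - j\<close> positions
    outside \<open>D \<union> U\<close>. Writing \<open>card B + j = i\<close> leaves no
    \<open>B\<close> when \<open>j > i\<close>, where \<open>i - j\<close> would truncate to
    0.\<close>
  define R where "R j = (SIGMA DU : disjoint_dominated_pairs P n j.
    {B. B \<subseteq> {1..n} - (fst DU \<union> snd DU) \<and> card B + j = i})" for j
  \<comment> \<open>Used with \<open>I = UNIV\<close> for sizes and \<open>I = {1..s}\<close> for
    domination: the common part contributes equally to both sides and cancels.\<close>
  have cut: "card (X \<inter> I) = card ((X - Y) \<inter> I) + card (X \<inter> Y \<inter> I)"
    if "finite X" for X Y I :: "nat set"
    using card_Un_disjoint[of "(X - Y) \<inter> I" "X \<inter> Y \<inter> I"] that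
    by (auto simp: Un_Int_distrib2[symmetric] Int_Un_distrib2[symmetric] Un_Diff_Int)
  have fin_sub: "finite X" if "X \<subseteq> {1..n}" for X :: "nat set"
    using that by (rule finite_subset) simp
  have fin_disj: "finite (disjoint_dominated_pairs P n j)" for j
    by (rule finite_subset[OF _ finite_dominated_pairs]) (auto simp: disjoint_dominated_pairs_def)
  have fin_rest: "finite {B. B \<subseteq> {1..n} - X \<and> card B + j = i}" for X j
    by (rule finite_subset[of _ "Pow {1..n}"]) auto
  have two: "2 * j \<le> n" "card ({1..n} - (fst DU \<union> snd DU)) = n - 2 * j"
    if "DU \<in> disjoint_dominated_pairs P n j" for DU j
  proof -
    have DU: "fst DU \<union> snd DU \<subseteq> {1..n}" "fst DU \<inter> snd DU = {}" "card (fst DU) = j" "card (snd DU) = j"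
      using that by (auto simp: disjoint_dominated_pairs_def dominated_pairs_def)
    then have *: "card (fst DU \<union> snd DU) = 2 * j"
      using card_Un_disjoint[of "fst DU" "snd DU"] by (simp add: fin_sub)
    then show "2 * j \<le> n" using card_mono[OF _ DU(1)] by simp
    show "card ({1..n} - (fst DU \<union> snd DU)) = n - 2 * j"
      using * DU(1) by (simp add: card_Diff_subset fin_sub)
  qed
  have card_R: "card (R j) = card (disjoint_dominated_pairs P n j) *
      (if j \<le> i then (n - 2 * j) choose (i - j) else 0)" for j
  proof -
    have "card {B. B \<subseteq> {1..n} - (fst DU \<union> snd DU) \<and> card B + j = i} =
        (if j \<le> i then (n - 2 * j) choose (i - j) else 0)"
      if "DU \<in> disjoint_dominated_pairs P n j" for DU
    proof (cases "j \<le> i")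
      case True
      then have "card B + j = i \<longleftrightarrow> card B = i - j" for B :: "nat set" by auto
      then show ?thesis using True n_subsets[of "{1..n} - (fst DU \<union> snd DU)" "i - j"] two[OF that] by simp
    qed auto
    then show ?thesis unfolding R_def by (simp add: fin_disj fin_rest)
  qed
  define f :: "nat set \<times> nat set \<Rightarrow> (nat set \<times> nat set) \<times> nat set"
    where "f = (\<lambda>(S, T). ((S - T, T - S), S \<inter> T))"
  define g :: "(nat set \<times> nat set) \<times> nat set \<Rightarrow> nat set \<times> nat set"
    where "g = (\<lambda>((D, U), B). (D \<union> B, U \<union> B))"
  have "bij_betw f (dominated_pairs P n i) (\<Union>j\<le>n div 2. R j)"
  proof (rule bij_betwI[where g = g])
    show "f \<in> dominated_pairs P n i \<rightarrow> (\<Union>j\<le>n div 2. R j)"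
    proof
      fix ST assume "ST \<in> dominated_pairs P n i"
      then obtain S T where ST: "ST = (S, T)" "S \<subseteq> {1..n}" "T \<subseteq> {1..n}" "card S = i" "card T = i"
        "\<And>s. s \<in> P \<Longrightarrow> card (S \<inter> {1..s}) \<le> card (T \<inter> {1..s})"
        by (auto simp: dominated_pairs_def)
      note fin = fin_sub[OF ST(2)] fin_sub[OF ST(3)]
      define j where "j = card (S - T)"
      have B: "card (S \<inter> T) + j = i" using cut[OF fin(1), of UNIV T] ST by (simp add: j_def)
      have "card (T - S) = j" using cut[OF fin(2), of UNIV S] ST B by (simp add: Int_commute)
      moreover have "card ((S - T) \<inter> {1..s}) \<le> card ((T - S) \<inter> {1..s})" if "s \<in> P" for s
        using ST(6)[OF that] cut[OF fin(1), of "{1..s}" T] cut[OF fin(2), of "{1..s}" S]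
        by (simp add: Int_commute)
      ultimately have DU: "(S - T, T - S) \<in> disjoint_dominated_pairs P n j"
        using ST by (auto simp: disjoint_dominated_pairs_def dominated_pairs_def j_def)
      moreover from two(1)[OF DU] have "j \<le> n div 2" by simp
      ultimately show "f ST \<in> (\<Union>j\<le>n div 2. R j)"
        using B ST by (auto simp: R_def f_def)
    qed
    show "g \<in> (\<Union>j\<le>n div 2. R j) \<rightarrow> dominated_pairs P n i"
    proof
      fix x assume "x \<in> (\<Union>j\<le>n div 2. R j)"
      then obtain D U B j where x: "x = ((D, U), B)" "D \<subseteq> {1..n}" "U \<subseteq> {1..n}" "D \<inter> U = {}"
        "card D = j" "card U = j" "\<And>s. s \<in> P \<Longrightarrow> card (D \<inter> {1..s}) \<le> card (U \<inter> {1..s})"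
        "B \<subseteq> {1..n}" "B \<inter> (D \<union> U) = {}" "card B + j = i"
        by (fastforce simp: R_def disjoint_dominated_pairs_def dominated_pairs_def)
      have *: "card ((X \<union> B) \<inter> I) = card (X \<inter> I) + card (B \<inter> I)"
        if "X \<subseteq> {1..n}" "B \<inter> X = {}" for X I
        using card_Un_disjoint[of "X \<inter> I" "B \<inter> I"] that x(8)
        by (auto simp: fin_sub Int_Un_distrib2)
      have BD: "B \<inter> D = {}" and BU: "B \<inter> U = {}" using x by auto
      have "card (D \<union> B) = i" "card (U \<union> B) = i"
        using *[OF x(2) BD, of UNIV] *[OF x(3) BU, of UNIV] x by simp_all
      moreover have "card ((D \<union> B) \<inter> {1..s}) \<le> card ((U \<union> B) \<inter> {1..s})" if "s \<in> P" for s
        using x(7)[OF that] by (simp add: *[OF x(2) BD] *[OF x(3) BU])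
      ultimately show "g x \<in> dominated_pairs P n i"
        using x by (simp add: g_def dominated_pairs_def)
    qed
    show "g (f x) = x" for x
      by (auto simp: f_def g_def split: prod.splits)
    show "f (g x) = x" if "x \<in> (\<Union>j\<le>n div 2. R j)" for x
      using that by (auto simp: f_def g_def R_def disjoint_dominated_pairs_def)
  qed
  then have "card (dominated_pairs P n i) = card (\<Union>j\<le>n div 2. R j)"
    by (rule bij_betw_same_card)
  also have "\<dots> = (\<Sum>j\<le>n div 2. card (R j))"
  proof (rule card_UN_disjoint)
    show "\<forall>j\<in>{..n div 2}. finite (R j)" by (simp add: R_def fin_disj fin_rest)
    show "\<forall>j\<in>{..n div 2}. \<forall>k\<in>{..n div 2}. j \<noteq> k \<longrightarrow> R j \<inter> R k = {}"
      by (auto simp: R_def disjoint_dominated_pairs_def dominated_pairs_def)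
  qed simp
  finally show ?thesis by (simp add: card_R)
qed

section \<open>Gamma expansion, symmetry and unimodality\<close>

lemma coeff_gamma_term:
  "coeff (monom (c :: 'a :: comm_ring_1) j * [:1, 1:] ^ m) i =
     c * of_nat (if j \<le> i then m choose (i - j) else 0)"
proof (cases "j \<le> i \<and> i - j \<le> m")
  case True
  then show ?thesis
    by (simp add: coeff_monom_mult coeff_linear_poly_power)
next
  \<comment> \<open>For \<open>i < j\<close> the guard gives 0, whereas the truncated
    \<open>i - j\<close> would give binomial 1; for \<open>i - j > m\<close> the degree bound
    applies.\<close>
  case False
  then show ?thesis
    using degree_linear_power[of "1 :: 'a" m] by (auto simp: coeff_monom_mult coeff_eq_0 binomial_eq_0)
qed

theorem theorem1p2:
  fixes n :: nat and \<sigma> :: "nat list"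
  assumes "0 < n" and "is_composition n \<sigma>"
  shows "(\<exists>\<gamma> :: nat \<Rightarrow> nat.
            h_poly \<sigma> = (\<Sum>i\<le>n div 2. monom (int (\<gamma> i)) i * [:1, 1:] ^ (n - 2 * i)))
       \<and> (\<forall>i\<le>n. h \<sigma> i = h \<sigma> (n - i))
       \<and> (\<forall>i<n div 2. h \<sigma> i \<le> h \<sigma> (Suc i))"
proof -
  have n: "sum_list \<sigma> = n" using assms by (simp add: is_composition_def)
  define P where "P = partial_sum \<sigma> ` {1..length \<sigma>}"
  have "partial_sum \<sigma> i \<le> n" for i
    unfolding partial_sum_def n[symmetric]
    by (subst (2) append_take_drop_id[of i \<sigma>, symmetric], subst sum_list_append) simp
  then have P: "P \<subseteq> {..n}" by (auto simp: P_def)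
  have "\<sigma> \<noteq> []" using n assms by auto
  then have "length \<sigma> \<in> {1..length \<sigma>}" by (cases \<sigma>) auto
  moreover have "partial_sum \<sigma> (length \<sigma>) = n" by (simp add: partial_sum_def n)
  ultimately have nP: "n \<in> P" unfolding P_def by force
  define \<gamma> where "\<gamma> j = card (disjoint_dominated_pairs P n j)" for j
  have "{a \<in> lattice_points \<sigma>. card {j \<in> {1..n}. a j \<noteq> 0} = i} = bounded_points P n i" for i
    by (auto simp: lattice_points_def bounded_points_def P_def n)
  then have h: "h \<sigma> i = (\<Sum>j\<le>n div 2. \<gamma> j * (if j \<le> i then (n - 2 * j) choose (i - j) else 0))" for i
    by (simp add: h_def n card_bounded_points[OF P nP] card_dominated_pairs \<gamma>_def)
  \<comment> \<open>\<open>h_poly\<close> stops at degree \<open>n\<close>; beyond it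
    \<open>i - j\<close> exceeds \<open>n - 2 * j\<close>, so every binomial vanishes.\<close>
  have h_big: "h \<sigma> i = 0" if "n < i" for i
    unfolding h using that by (intro sum.neutral) auto
  have "h_poly \<sigma> = (\<Sum>i\<le>n div 2. monom (int (\<gamma> i)) i * [:1, 1:] ^ (n - 2 * i))"
  proof (rule poly_eqI)
    fix i
    have "coeff (h_poly \<sigma>) i = (\<Sum>k\<le>n. if k = i then int (h \<sigma> k) else 0)"
      by (simp add: h_poly_def n coeff_sum)
    also have "\<dots> = int (h \<sigma> i)" using h_big[of i] by simp
    also have "\<dots> = coeff (\<Sum>i\<le>n div 2. monom (int (\<gamma> i)) i * [:1, 1:] ^ (n - 2 * i)) i"
      by (simp only: h coeff_sum coeff_gamma_term of_nat_sum of_nat_mult)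
    finally show "coeff (h_poly \<sigma>) i =
      coeff (\<Sum>i\<le>n div 2. monom (int (\<gamma> i)) i * [:1, 1:] ^ (n - 2 * i)) i" .
  qed
  moreover have "h \<sigma> i = h \<sigma> (n - i)" if "i \<le> n" for i
    unfolding h
  proof (intro sum.cong refl arg_cong2[where f = "(*)"])
    fix j assume "j \<in> {..n div 2}"
    then have j: "2 * j \<le> n" by auto
    show "(if j \<le> i then (n - 2 * j) choose (i - j) else 0) =
      (if j \<le> n - i then (n - 2 * j) choose (n - i - j) else 0)"
    proof (cases "j \<le> i \<and> j \<le> n - i")
      case True
      then have "n - 2 * j - (i - j) = n - i - j" "i - j \<le> n - 2 * j" using that by auto
      then show ?thesis using True binomial_symmetric[of "i - j" "n - 2 * j"] by simp
    next
      \<comment> \<open>If one guard fails, the lower index on the other side exceeds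
        \<open>n - 2 * j\<close>, so both sides are 0.\<close>
      case False
      then show ?thesis using that j by auto
    qed
  qed
  moreover have "h \<sigma> i \<le> h \<sigma> (Suc i)" if "i < n div 2" for i
    unfolding h
  \<comment> \<open>Each summand grows: \<open>2 * Suc i \<le> n\<close> keeps
    \<open>Suc i - j\<close> in the increasing half of the binomial row
    \<open>n - 2 * j\<close>.\<close>
  proof (intro sum_mono mult_le_mono2)
    fix j
    show "(if j \<le> i then (n - 2 * j) choose (i - j) else 0) \<le>
      (if j \<le> Suc i then (n - 2 * j) choose (Suc i - j) else 0)"
      using that binomial_mono[of "i - j" "Suc i - j" "n - 2 * j"] by auto
  qed
  ultimately show ?thesis by blast
qed

end
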